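(* Let $p,q$ be distinct primes and $R=\mathbb{Z}_{pq}[x]/(x^2)$. The subgraphs of the cozero-divisor graph $\Gamma'(R)$ induced on the sets $\mathcal{A}_{i,j}$ are: \[ \Gamma'(\mathcal{A}_{1,2})\cong \overline{K}_{q-1},\quad \Gamma'(\mathcal{A}_{2,1})\cong \overline{K}_{p-1},\quad \Gamma'(\mathcal{A}_{1,3})\cong \overline{K}_{q(q-1)},\quad \Gamma'(\mathcal{A}_{3,1})\cong \overline{K}_{p(p-1)}, \] \[ \Gamma'(\mathcal{A}_{2,2})\cong \overline{K}_{(p-1)(q-1)},\quad \Gamma'(\mathcal{A}_{2,3})\cong \overline{K}_{q(p-1)(q-1)},\quad \Gamma'(\mathcal{A}_{3,2})\cong \overline{K}_{p(p-1)(q-1)}. \]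
   Context: For a commutative ring $R$ with nonzero identity, the cozero-divisor graph $\Gamma'(R)$ is the simple undirected graph whose vertices are the nonzero non-unit elements of $R$, with two distinct vertices $u,v$ adjacent if and only if $u\notin Rv$ and $v\notin Ru$. $\overline{K}_m$ denotes the graph with $m$ vertices and no edges, and $\Gamma'(\mathcal{A})$ denotes the subgraph of $\Gamma'(R)$ induced on a vertex subset $\mathcal{A}$. $\mathbb{Z}_n$ denotes the ring of integers modulo $n$. By the Chinese remainder theorem, $\mathbb{Z}_{pq}[x]/(x^2)\cong \mathbb{Z}_p[x]/(x^2)\times \mathbb{Z}_q[x]/(x^2)$; for $f=ax+b\in \mathbb{Z}_{pq}[x]/(x^2)$ let $f_p$ and $f_q$ denote its images (reduction of $a,b$ modulo $p$ and $q$) in the two factors. In $\mathbb{Z}_p[x]/(x^2)$ put $I_1=\langle 0\rangle$, $I_2=\langle x\rangle$, $I_3=\mathbb{Z}_p[x]/(x^2)$ (the ideal generated by any $ax+b$ with $b\in\mathbb{Z}_p^\times$); in $\mathbb{Z}_q[x]/(x^2)$ put $J_1=\langle 0\rangle$, $J_2=\langle x\rangle$, $J_3=\mathbb{Z}_q[x]/(x^2)$. Define \[ \mathcal{A}_{i,j}=\{f\in \mathbb{Z}_{pq}[x]/(x^2): \langle f_p\rangle=I_i \text{ and } \langle f_q\rangle=J_j\}. \] *)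

theory Defs
  imports
    "HOL-Number_Theory.Residues"
    "HOL-Algebra.UnivPoly"
    "HOL-Algebra.QuotRing"
    "Graph_Theory.Pair_Digraph"
    "Graph_Theory.Digraph_Isomorphism"
begin

section \<open>Graphs\<close>

text \<open>A simple undirected graph is modelled as a symmetric loop-free digraph whose arcs are
  pairs of vertices: an edge between \<open>u\<close> and \<open>v\<close> is the pair of arcs \<open>(u, v)\<close>, \<open>(v, u)\<close>.
  The set \<open>PIdl\<^bsub>R\<^esub> v\<close> is by definition \<open>{x \<otimes>\<^bsub>R\<^esub> v | x. x \<in> carrier R}\<close>.\<close>

definition cozero_divisor_graph :: "('a, 'm) ring_scheme \<Rightarrow> ('a, 'a \<times> 'a) pre_digraph" where
  "cozero_divisor_graph R =
     (let V = carrier R - {\<zero>\<^bsub>R\<^esub>} - Units R in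
      with_proj \<lparr> pverts = V,
        parcs = {(u, v). u \<in> V \<and> v \<in> V \<and> u \<noteq> v \<and> u \<notin> PIdl\<^bsub>R\<^esub> v \<and> v \<notin> PIdl\<^bsub>R\<^esub> u} \<rparr>)"

definition edgeless_graph :: "nat \<Rightarrow> (nat, nat \<times> nat) pre_digraph" where
  "edgeless_graph m = with_proj \<lparr> pverts = {..<m}, parcs = {} \<rparr>"

lemma sym_digraph_cozero_divisor_graph: "sym_digraph (cozero_divisor_graph R)"
  by unfold_locales (auto simp: cozero_divisor_graph_def Let_def symmetric_def sym_def)

lemma loopfree_digraph_cozero_divisor_graph: "loopfree_digraph (cozero_divisor_graph R)"
  by unfold_locales (auto simp: cozero_divisor_graph_def Let_def)

section \<open>The ring of integers modulo \<open>n\<close> with an adjoined square-zero element\<close>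

abbreviation zmod_poly :: "nat \<Rightarrow> (int, nat \<Rightarrow> int) up_ring" where
  "zmod_poly n \<equiv> UP (residue_ring (int n))"

definition x_squared_ideal :: "nat \<Rightarrow> (nat \<Rightarrow> int) set" where
  "x_squared_ideal n =
     Idl\<^bsub>zmod_poly n\<^esub> {monom (zmod_poly n) \<one>\<^bsub>residue_ring (int n)\<^esub> 2}"

definition zmod_dual :: "nat \<Rightarrow> (nat \<Rightarrow> int) set ring" where
  "zmod_dual n = zmod_poly n Quot x_squared_ideal n"

definition x_class :: "nat \<Rightarrow> (nat \<Rightarrow> int) set" where
  "x_class n = x_squared_ideal n +>\<^bsub>zmod_poly n\<^esub>
     monom (zmod_poly n) \<one>\<^bsub>residue_ring (int n)\<^esub> 1"

text \<open>For \<open>m\<close> dividing \<open>n\<close>, the map \<open>zmod_dual n \<rightarrow> zmod_dual m\<close> reducing coefficients modulo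
  \<open>m\<close>. Polynomials in \<^const>\<open>UP\<close> are their coefficient functions, and \<open>C\<close> is a coset of polynomials,
  all of whose reductions lie in one coset.\<close>

definition reduce_mod :: "nat \<Rightarrow> (nat \<Rightarrow> int) set \<Rightarrow> (nat \<Rightarrow> int) set" where
  "reduce_mod m C =
     the_elem ((\<lambda>f. x_squared_ideal m +>\<^bsub>zmod_poly m\<^esub> (\<lambda>i. f i mod int m)) ` C)"

text \<open>The ideals \<open>I\<^sub>i\<close> (for \<open>n = p\<close>) and \<open>J\<^sub>i\<close> (for \<open>n = q\<close>); only the indices
  \<open>1, 2, 3\<close> are meaningful.\<close>

definition dual_ideal :: "nat \<Rightarrow> nat \<Rightarrow> (nat \<Rightarrow> int) set set" where
  "dual_ideal n i =
     (if i = 1 then Idl\<^bsub>zmod_dual n\<^esub> {\<zero>\<^bsub>zmod_dual n\<^esub>}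
      else if i = 2 then Idl\<^bsub>zmod_dual n\<^esub> {x_class n}
      else carrier (zmod_dual n))"

definition ideal_class :: "nat \<Rightarrow> nat \<Rightarrow> nat \<Rightarrow> nat \<Rightarrow> (nat \<Rightarrow> int) set set" where
  "ideal_class p q i j = {f \<in> carrier (zmod_dual (p * q)).
     Idl\<^bsub>zmod_dual p\<^esub> {reduce_mod p f} = dual_ideal p i \<and>
     Idl\<^bsub>zmod_dual q\<^esub> {reduce_mod q f} = dual_ideal q j}"

end

(* Every element of Z_n[x]/(x^2) is the class of a unique a + b x with a, b mod n. Reduction
   modulo p and q maps the class with index (i, j) bijectively onto pairs (generator of I_i,
   generator of J_j), which gives the cardinalities. Two elements of the same class have the same
   principal ideals in both factors, so by the Chinese remainder theorem they are multiples of each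
   other and hence not adjacent. *)

theory Submission
  imports Defs
begin

section \<open>The ideal generated by the square of the variable, and its cosets\<close>

context UP_cring
begin

text \<open>In the convolution sum only the index \<open>k\<close> with \<open>k + 2 = i\<close>
  survives, so the product shifts the coefficients up by two.\<close>

lemma coeff_mult_monom_2:
  assumes "h \<in> carrier P"
  shows "coeff P (h \<otimes>\<^bsub>P\<^esub> monom P \<one> 2) i = (if 2 \<le> i then coeff P h (i - 2) else \<zero>)"
proof -
  have eq: "coeff P (h \<otimes>\<^bsub>P\<^esub> monom P \<one> 2) i =
      (\<Oplus>k \<in> {..i}. if k + 2 = i then coeff P h k else \<zero>)"
    using assms by (auto simp: coeff_mult intro!: R.finsum_cong')
  show ?thesis
  proof (cases "2 \<le> i")
    case True
    then have "coeff P (h \<otimes>\<^bsub>P\<^esub> monom P \<one> 2) i =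
        (\<Oplus>k \<in> {..i}. if i - 2 = k then coeff P h k else \<zero>)"
      unfolding eq using assms by (intro R.finsum_cong') auto
    also have "\<dots> = coeff P h (i - 2)"
      using assms True by (subst R.finsum_singleton) auto
    finally show ?thesis using True by simp
  next
    case False
    then have "coeff P (h \<otimes>\<^bsub>P\<^esub> monom P \<one> 2) i = (\<Oplus>k \<in> {..i}. \<zero>)"
      unfolding eq by (intro R.finsum_cong') auto
    then show ?thesis using False by simp
  qed
qed

lemma genideal_monom_2:
  "Idl\<^bsub>P\<^esub> {monom P \<one> 2} = {f \<in> carrier P. coeff P f 0 = \<zero> \<and> coeff P f 1 = \<zero>}"
proof -
  have "\<exists>h \<in> carrier P. f = h \<otimes>\<^bsub>P\<^esub> monom P \<one> 2"
    if f: "f \<in> carrier P" "coeff P f 0 = \<zero>" "coeff P f 1 = \<zero>" for f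
  proof -
    \<comment> \<open>Division by the square of the variable: the two lowest coefficients vanish, so
      dropping them loses nothing, and a degree bound for \<open>f\<close> also bounds
      \<open>h\<close>.\<close>
    define h where "h = (\<lambda>i. coeff P f (i + 2))"
    from f(1) obtain N where "bound \<zero> N (coeff P f)"
      by (auto simp: P_def UP_def up_def)
    then have "bound \<zero> N h"
      unfolding h_def by (intro bound.intro) (simp add: bound.bound)
    with f(1) have h: "h \<in> up R"
      unfolding h_def by (intro mem_upI exI[of _ N]) auto
    then have hP: "h \<in> carrier P" and ch: "coeff P h = h"
      by (simp_all add: P_def UP_def fun_eq_iff)
    have "f = h \<otimes>\<^bsub>P\<^esub> monom P \<one> 2"
    proof (rule up_eqI)
      fix i
      show "coeff P f i = coeff P (h \<otimes>\<^bsub>P\<^esub> monom P \<one> 2) i"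
        unfolding coeff_mult_monom_2[OF hP] ch
        using f by (cases "i = 0"; cases "i = 1") (auto simp: h_def simp flip: Suc_diff_le numeral_2_eq_2)
    qed (use f hP in auto)
    with hP show ?thesis by blast
  qed
  then show ?thesis
    unfolding cgenideal_eq_genideal[OF monom_closed[OF R.one_closed], symmetric]
    by (auto simp: cgenideal_def coeff_mult_monom_2)
qed

lemma ideal_monom_2: "ideal (Idl\<^bsub>P\<^esub> {monom P \<one> 2}) P"
  by (intro P.genideal_ideal) auto

text \<open>Two polynomials are congruent iff their difference lies in the ideal, that is, iff their
  two lowest coefficients agree. A coset is therefore recorded by two coefficients.\<close>

lemma rcos_monom_2:
  assumes f: "f \<in> carrier P"
  shows "Idl\<^bsub>P\<^esub> {monom P \<one> 2} +>\<^bsub>P\<^esub> f =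
    {g \<in> carrier P. coeff P g 0 = coeff P f 0 \<and> coeff P g 1 = coeff P f 1}"
proof (intro equalityI subsetI)
  fix g assume "g \<in> Idl\<^bsub>P\<^esub> {monom P \<one> 2} +>\<^bsub>P\<^esub> f"
  then show "g \<in> {g \<in> carrier P. coeff P g 0 = coeff P f 0 \<and> coeff P g 1 = coeff P f 1}"
    using f by (auto simp: a_r_coset_def' genideal_monom_2)
next
  fix g assume "g \<in> {g \<in> carrier P. coeff P g 0 = coeff P f 0 \<and> coeff P g 1 = coeff P f 1}"
  then have g: "g \<in> carrier P" "coeff P g 0 = coeff P f 0" "coeff P g 1 = coeff P f 1"
    by auto
  have "g \<ominus>\<^bsub>P\<^esub> f \<in> Idl\<^bsub>P\<^esub> {monom P \<one> 2}"
    using f g by (auto simp: genideal_monom_2 a_minus_def R.r_neg)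
  moreover have "g = (g \<ominus>\<^bsub>P\<^esub> f) \<oplus>\<^bsub>P\<^esub> f"
    using f g by algebra
  ultimately show "g \<in> Idl\<^bsub>P\<^esub> {monom P \<one> 2} +>\<^bsub>P\<^esub> f"
    by (auto simp: a_r_coset_def')
qed

end

text \<open>The residue class of \<open>a + b x\<close>.\<close>

definition dual :: "nat \<Rightarrow> int \<Rightarrow> int \<Rightarrow> (nat \<Rightarrow> int) set" where
  "dual n a b = {f \<in> carrier (zmod_poly n). f 0 = a mod int n \<and> f 1 = b mod int n}"

section \<open>Arithmetic of the quotient ring in the coordinates \<open>dual n a b\<close>\<close>

locale zmod_dual_ring =
  fixes n :: nat
  assumes n_gt_1: "1 < n"
begin

sublocale residues "int n" "residue_ring (int n)"
  using n_gt_1 by unfold_locales simp_all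

sublocale P: UP_cring "residue_ring (int n)" "zmod_poly n"
  by unfold_locales simp_all

lemma coeff_zmod_poly: "f \<in> carrier (zmod_poly n) \<Longrightarrow> coeff (zmod_poly n) f i = f i"
  by (simp add: UP_def)

lemma ideal_x_squared: "ideal (x_squared_ideal n) (zmod_poly n)"
  unfolding x_squared_ideal_def by (rule P.ideal_monom_2)

lemma cring_zmod_dual: "cring (zmod_dual n)"
  unfolding zmod_dual_def
  by (rule ideal.quotient_is_cring[OF ideal_x_squared]) (rule P.P.is_cring)

sublocale D: cring "zmod_dual n"
  by (rule cring_zmod_dual)

lemma rcos_eq_dual:
  assumes "f \<in> carrier (zmod_poly n)"
  shows "x_squared_ideal n +>\<^bsub>zmod_poly n\<^esub> f = dual n (f 0) (f 1)"
proof -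
  have "f i mod int n = f i" for i
    using P.coeff_closed[OF assms, of i] assms by (simp add: coeff_zmod_poly res_carrier_eq)
  then show ?thesis
    unfolding x_squared_ideal_def P.rcos_monom_2[OF assms] dual_def
    using assms by (auto simp: coeff_zmod_poly)
qed

text \<open>A polynomial of degree at most one representing the coset \<open>dual n a b\<close>. It
  shows that this coset is nonempty and lets ring operations on cosets be computed on
  polynomials.\<close>

definition lin :: "int \<Rightarrow> int \<Rightarrow> nat \<Rightarrow> int" where
  "lin a b = monom (zmod_poly n) (a mod int n) 0 \<oplus>\<^bsub>zmod_poly n\<^esub>
     monom (zmod_poly n) (b mod int n) 1"

lemma lin_closed: "lin a b \<in> carrier (zmod_poly n)"
  unfolding lin_def by (intro P.P.a_closed P.monom_closed mod_in_carrier)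

lemma lin_0: "lin a b 0 = a mod int n"
  and lin_1: "lin a b 1 = b mod int n"
proof -
  have c: "lin a b i = coeff (zmod_poly n) (monom (zmod_poly n) (a mod int n) 0) i
      \<oplus>\<^bsub>residue_ring (int n)\<^esub>
      coeff (zmod_poly n) (monom (zmod_poly n) (b mod int n) 1) i" for i
  proof -
    have "lin a b i = coeff (zmod_poly n) (lin a b) i"
      by (rule coeff_zmod_poly[OF lin_closed, symmetric])
    then show ?thesis
      unfolding lin_def by (simp only: P.coeff_add P.monom_closed mod_in_carrier)
  qed
  have "lin a b 0 = (a mod int n + 0) mod int n" "lin a b 1 = (0 + b mod int n) mod int n"
    unfolding c P.coeff_monom[OF mod_in_carrier] unfolding res_add_eq res_zero_eq
    by simp_all
  then show "lin a b 0 = a mod int n" "lin a b 1 = b mod int n"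
    by simp_all
qed

lemma dual_eq_rcos: "dual n a b = x_squared_ideal n +>\<^bsub>zmod_poly n\<^esub> lin a b"
  unfolding rcos_eq_dual[OF lin_closed] lin_0 lin_1 by (simp add: dual_def)

lemma lin_mem_dual: "lin a b \<in> dual n a b"
  using lin_closed lin_0 lin_1 by (simp add: dual_def)

lemma dual_eq_iff: "dual n a b = dual n c d \<longleftrightarrow> [a = c] (mod int n) \<and> [b = d] (mod int n)"
proof
  assume "dual n a b = dual n c d"
  then have "lin a b \<in> dual n c d"
    using lin_mem_dual by blast
  then show "[a = c] (mod int n) \<and> [b = d] (mod int n)"
    unfolding dual_def mem_Collect_eq lin_0 lin_1 cong_def by blast
qed (simp add: dual_def cong_def)

lemma carrier_zmod_dual: "carrier (zmod_dual n) = {dual n a b | a b. True}"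
proof -
  have "x_squared_ideal n +>\<^bsub>zmod_poly n\<^esub> lin a b \<in> carrier (zmod_dual n)" for a b
    using lin_closed by (auto simp: zmod_dual_def FactRing_simps)
  then show ?thesis
    unfolding dual_eq_rcos[symmetric]
    by (auto simp: zmod_dual_def FactRing_simps rcos_eq_dual)
qed

lemma dual_closed [simp]: "dual n a b \<in> carrier (zmod_dual n)"
  unfolding carrier_zmod_dual by blast

text \<open>Cosets multiply through their representatives, and the coset of the product depends only
  on its coefficients at 0 and 1. The term in \<open>b * d\<close> has degree two and disappears in
  the quotient.\<close>

lemma mult_dual:
  "dual n a b \<otimes>\<^bsub>zmod_dual n\<^esub> dual n c d = dual n (a * c) (a * d + b * c)"
proof -
  let ?f = "lin a b \<otimes>\<^bsub>zmod_poly n\<^esub> lin c d"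
  have f: "?f \<in> carrier (zmod_poly n)"
    by (intro P.P.m_closed lin_closed)
  have c: "lin a b i \<in> carrier (residue_ring (int n))" for a b i
    using P.coeff_closed[OF lin_closed] by (simp add: coeff_zmod_poly lin_closed)
  have f0: "?f 0 = (a * c) mod int n"
    unfolding coeff_zmod_poly[OF f, symmetric] P.coeff_mult[OF lin_closed lin_closed]
    by (simp add: coeff_zmod_poly lin_closed c lin_0 mult_cong)
  have "?f 1 = lin a b 1 \<otimes>\<^bsub>residue_ring (int n)\<^esub> lin c d 0
      \<oplus>\<^bsub>residue_ring (int n)\<^esub> lin a b 0 \<otimes>\<^bsub>residue_ring (int n)\<^esub> lin c d 1"
    unfolding coeff_zmod_poly[OF f, symmetric] P.coeff_mult[OF lin_closed lin_closed]
    unfolding One_nat_def by (subst finsum_Suc) (simp_all add: coeff_zmod_poly lin_closed c)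
  also have "\<dots> = (a * d + b * c) mod int n"
    unfolding lin_0 lin_1 mult_cong add_cong by (simp add: add.commute)
  finally have f1: "?f 1 = (a * d + b * c) mod int n" .
  have "dual n a b \<otimes>\<^bsub>zmod_dual n\<^esub> dual n c d = x_squared_ideal n +>\<^bsub>zmod_poly n\<^esub> ?f"
    unfolding dual_eq_rcos
    by (simp add: zmod_dual_def FactRing_def ideal.rcoset_mult_add[OF ideal_x_squared] lin_closed)
  then show ?thesis
    unfolding rcos_eq_dual[OF f] f0 f1 by (simp add: dual_def)
qed

lemma one_zmod_dual: "\<one>\<^bsub>zmod_dual n\<^esub> = dual n 1 0"
proof -
  have "\<one>\<^bsub>zmod_dual n\<^esub> = x_squared_ideal n +>\<^bsub>zmod_poly n\<^esub> \<one>\<^bsub>zmod_poly n\<^esub>"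
    by (simp add: zmod_dual_def FactRing_def)
  then show ?thesis
    by (simp add: rcos_eq_dual) (simp add: UP_def res_one_eq res_zero_eq)
qed

lemma zero_zmod_dual: "\<zero>\<^bsub>zmod_dual n\<^esub> = dual n 0 0"
proof -
  have "\<zero>\<^bsub>zmod_dual n\<^esub> = x_squared_ideal n"
    by (simp add: zmod_dual_def FactRing_def)
  also have "\<dots> = dual n 0 0"
    unfolding x_squared_ideal_def P.genideal_monom_2 dual_def
    by (auto simp: coeff_zmod_poly res_zero_eq)
  finally show ?thesis .
qed

lemma x_class_eq: "x_class n = dual n 0 1"
proof -
  let ?X = "monom (zmod_poly n) \<one>\<^bsub>residue_ring (int n)\<^esub> 1"
  have X: "?X \<in> carrier (zmod_poly n)"
    by (intro P.monom_closed one_closed)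
  have "?X i = (if i = 1 then 1 else 0)" for i
    unfolding coeff_zmod_poly[OF X, symmetric] P.coeff_monom[OF one_closed]
    by (simp add: res_one_eq res_zero_eq)
  then show ?thesis
    unfolding x_class_def rcos_eq_dual[OF X] by simp
qed

lemma genideal_zmod_dual:
  assumes "u \<in> carrier (zmod_dual n)"
  shows "Idl\<^bsub>zmod_dual n\<^esub> {u} = PIdl\<^bsub>zmod_dual n\<^esub> u"
  using D.cgenideal_eq_genideal[OF assms] by simp

text \<open>The ideal consists of the multiples of the generator; \<open>x\<close> and
  \<open>y\<close> are the two coordinates of an arbitrary multiplier
  \<open>dual n x y\<close>.\<close>

lemma genideal_dual:
  "Idl\<^bsub>zmod_dual n\<^esub> {dual n c d} = {dual n (x * c) (x * d + y * c) | x y. True}"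
  unfolding genideal_zmod_dual[OF dual_closed] cgenideal_def carrier_zmod_dual
  by (auto simp: mult_dual; metis mult_dual)

lemma dual_mem_PIdl_iff:
  "dual n a b \<in> PIdl\<^bsub>zmod_dual n\<^esub> (dual n c d) \<longleftrightarrow>
    (\<exists>x y. [a = x * c] (mod int n) \<and> [b = x * d + y * c] (mod int n))"
  unfolding genideal_zmod_dual[OF dual_closed, symmetric] genideal_dual
  by (auto simp: dual_eq_iff)

end

section \<open>Reduction of coefficients modulo a divisor\<close>

text \<open>This justifies \<open>the_elem\<close> in \<open>reduce_mod\<close>: since
  \<open>m\<close> divides \<open>n\<close>, all representatives of a coset have the same two lowest
  coefficients modulo \<open>m\<close>, so their reductions give a single coset.\<close>

lemma reduce_mod_dual:
  assumes "1 < m" "m dvd n" "1 < n"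
  shows "reduce_mod m (dual n a b) = dual m a b"
proof -
  interpret N: zmod_dual_ring n by unfold_locales fact
  interpret M: zmod_dual_ring m by unfold_locales fact
  have "x_squared_ideal m +>\<^bsub>zmod_poly m\<^esub> (\<lambda>i. f i mod int m) = dual m a b"
    if f: "f \<in> dual n a b" for f
  proof -
    from f have "f \<in> up (residue_ring (int n))"
      by (simp add: dual_def UP_def)
    then obtain N where "bound 0 N f"
      unfolding up_def N.res_zero_eq by blast
    \<comment> \<open>Reduction keeps zero coefficients zero, so the reduced function is still a
      polynomial.\<close>
    then have "bound 0 N (\<lambda>i. f i mod int m)"
      by (auto intro!: bound.intro dest: bound.bound)
    then have "(\<lambda>i. f i mod int m) \<in> carrier (zmod_poly m)"
      unfolding UP_def using M.mod_in_carrier M.res_zero_eq by (auto simp: up_def)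
    then have "x_squared_ideal m +>\<^bsub>zmod_poly m\<^esub> (\<lambda>i. f i mod int m) =
        dual m (f 0 mod int m) (f 1 mod int m)"
      by (rule M.rcos_eq_dual)
    also have "\<dots> = dual m a b"
      using f assms(2) by (simp add: dual_def mod_mod_cancel)
    finally show ?thesis .
  qed
  then have "(\<lambda>f. x_squared_ideal m +>\<^bsub>zmod_poly m\<^esub> (\<lambda>i. f i mod int m)) ` dual n a b = {dual m a b}"
    using N.lin_mem_dual by blast
  then show ?thesis
    unfolding reduce_mod_def by simp
qed

text \<open>The part of \<open>ideal_class\<close> that is visible in one factor; the Chinese
  remainder theorem later assembles \<open>ideal_class\<close> from two such sets.\<close>

definition ideal_gens :: "nat \<Rightarrow> nat \<Rightarrow> (nat \<Rightarrow> int) set set" where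
  "ideal_gens n i = {u \<in> carrier (zmod_dual n). Idl\<^bsub>zmod_dual n\<^esub> {u} = dual_ideal n i}"

lemma reduce_mod_dual_mult:
  assumes "1 < p" "1 < q"
  shows "reduce_mod p (dual (p * q) a b) = dual p a b"
    and "reduce_mod q (dual (p * q) a b) = dual q a b"
  using assms less_1_mult[OF assms] by (simp_all add: reduce_mod_dual)

text \<open>The index \<open>i\<close> for which \<open>a + b x\<close> generates \<^term>\<open>dual_ideal n i\<close> when \<open>n\<close> is prime.\<close>

definition dual_ideal_index :: "nat \<Rightarrow> int \<Rightarrow> int \<Rightarrow> nat" where
  "dual_ideal_index n a b = (if \<not> int n dvd a then 3 else if \<not> int n dvd b then 2 else 1)"

section \<open>Prime modulus: classification and counting of generators\<close>

locale zmod_dual_field =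
  fixes p :: nat
  assumes prime_p: "prime p"
begin

sublocale zmod_dual_ring p
  using prime_p by unfold_locales (rule prime_gt_1_nat)

lemma dual_ideal_1: "dual_ideal p 1 = {dual p 0 0}"
  unfolding dual_ideal_def by (simp add: zero_zmod_dual genideal_dual)

lemma dual_ideal_2: "dual_ideal p 2 = {dual p 0 y | y. True}"
  unfolding dual_ideal_def by (simp add: x_class_eq genideal_dual)

lemma dual_ideal_3: "dual_ideal p 3 = carrier (zmod_dual p)"
  unfolding dual_ideal_def by simp

lemma inverse_mod_p:
  assumes "\<not> int p dvd a"
  obtains e where "[a * e = 1] (mod int p)"
proof -
  have "coprime a (int p)"
    using assms prime_p by (metis coprime_commute prime_imp_coprime prime_nat_int_transfer)
  then show thesis
    using that by (auto simp: coprime_iff_invertible_int)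
qed

text \<open>Three cases: an element with constant coefficient prime to \<open>p\<close> is a unit;
  if only the other coefficient is prime to \<open>p\<close>, the element is a unit multiple of
  \<open>x_class p\<close>; otherwise it is zero.\<close>

lemma genideal_eq_dual_ideal:
  "Idl\<^bsub>zmod_dual p\<^esub> {dual p a b} = dual_ideal p (dual_ideal_index p a b)"
proof (cases "int p dvd a")
  case False
  then obtain e where e: "[a * e = 1] (mod int p)"
    by (rule inverse_mod_p)
  \<comment> \<open>The inverse of \<open>dual p a b\<close> is
    \<open>dual p e (- e * e * b)\<close>; multiplying it by \<open>dual p c d\<close> yields the
    multiplier with coordinates \<open>e * c\<close> and \<open>e * (d - e * c * b)\<close>.\<close>
  have "dual p c d = dual p ((e * c) * a) ((e * c) * b + (e * (d - e * c * b)) * a)" for c d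
  proof -
    have "[(e * c) * a = c] (mod int p)"
      using cong_scalar_right[OF e, of c] by (simp add: ac_simps)
    moreover have "[(e * c) * b + (a * e) * (d - e * c * b) = (e * c) * b + 1 * (d - e * c * b)] (mod int p)"
      by (intro cong_add cong_mult e cong_refl)
    ultimately show ?thesis
      by (simp add: dual_eq_iff cong_sym_eq ac_simps)
  qed
  then have "Idl\<^bsub>zmod_dual p\<^esub> {dual p a b} = carrier (zmod_dual p)"
    unfolding genideal_dual carrier_zmod_dual by blast
  with False show ?thesis by (simp add: dual_ideal_3 dual_ideal_index_def)
next
  case a: True
  show ?thesis
  proof (cases "int p dvd b")
    case False
    then obtain e where e: "[b * e = 1] (mod int p)"
      by (rule inverse_mod_p)
    \<comment> \<open>All terms containing \<open>a\<close> vanish modulo \<open>p\<close>. What is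
      left is a multiple of \<open>b\<close>, and the inverse \<open>e\<close> of \<open>b\<close>
      makes every residue such a multiple.\<close>
    have *: "dual p (x * a) (x * b + y * a) = dual p 0 (x * b)" for x y
      using a by (simp add: dual_eq_iff cong_iff_dvd_diff)
    have "dual p 0 y = dual p 0 ((y * e) * b)" for y
      using cong_scalar_left[OF e, of y] by (simp add: dual_eq_iff cong_sym_eq ac_simps)
    then have "Idl\<^bsub>zmod_dual p\<^esub> {dual p a b} = {dual p 0 y | y. True}"
      unfolding genideal_dual * by blast
    with a False show ?thesis by (simp add: dual_ideal_2 dual_ideal_index_def)
  next
    case True
    with a have "dual p a b = \<zero>\<^bsub>zmod_dual p\<^esub>"
      by (simp add: zero_zmod_dual dual_eq_iff cong_0_iff)
    with a True show ?thesis by (simp add: dual_ideal_def dual_ideal_index_def)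
  qed
qed

text \<open>The classes of 1 and of the variable separate the ideals: the variable lies in the
  second but not the first, and 1 lies only in the third.\<close>

lemma dual_ideal_inj: "inj_on (dual_ideal p) {1, 2, 3}"
proof -
  have a: "dual p 0 1 \<notin> dual_ideal p 1" and b: "dual p 1 0 \<notin> dual_ideal p 1"
    and c: "dual p 1 0 \<notin> dual_ideal p 2"
    using n_gt_1 unfolding dual_ideal_1 dual_ideal_2 by (auto simp: dual_eq_iff cong_def)
  have d: "dual p 0 1 \<in> dual_ideal p 2"
    unfolding dual_ideal_2 by blast
  have e: "dual p 1 0 \<in> dual_ideal p 3"
    unfolding dual_ideal_3 by simp
  have "dual_ideal p 1 \<noteq> dual_ideal p 2"
    using a d by metis
  moreover have "dual_ideal p 1 \<noteq> dual_ideal p 3"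
    using b e by metis
  moreover have "dual_ideal p 2 \<noteq> dual_ideal p 3"
    using c e by metis
  ultimately show ?thesis
    by (simp add: inj_on_def)
qed

text \<open>As the three ideals are distinct, the generated ideal determines its index, and
  membership becomes a divisibility test on the coordinates.\<close>

lemma dual_mem_ideal_gens_iff:
  assumes "i \<in> {1, 2, 3}"
  shows "dual p a b \<in> ideal_gens p i \<longleftrightarrow> dual_ideal_index p a b = i"
proof -
  have "dual_ideal p (dual_ideal_index p a b) = dual_ideal p i \<longleftrightarrow> dual_ideal_index p a b = i"
    by (rule inj_on_eq_iff[OF dual_ideal_inj _ assms]) (simp add: dual_ideal_index_def)
  then show ?thesis
    by (simp add: ideal_gens_def genideal_eq_dual_ideal)
qed

lemma zero_mem_ideal_gens:
  assumes "i \<in> {1, 2, 3}"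
  shows "dual p 0 0 \<in> ideal_gens p i \<longleftrightarrow> i = 1"
  unfolding dual_mem_ideal_gens_iff[OF assms] by (auto simp: dual_ideal_index_def)

text \<open>Taking least nonnegative residues as coordinates turns counting generators into counting
  pairs of integers; \<open>inj_on_dual\<close> ensures that no generator is counted twice.\<close>

lemma ideal_gens_eq_image:
  assumes "i \<in> {1, 2, 3}"
  shows "ideal_gens p i = (\<lambda>(a, b). dual p a b) `
    {w \<in> {0..<int p} \<times> {0..<int p}. dual_ideal_index p (fst w) (snd w) = i}"
proof (intro equalityI subsetI)
  fix u assume u: "u \<in> ideal_gens p i"
  then obtain a b where "u = dual p a b"
    unfolding ideal_gens_def carrier_zmod_dual by blast
  then have *: "u = dual p (a mod int p) (b mod int p)"
    by (simp add: dual_eq_iff cong_def)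
  then have "dual_ideal_index p (a mod int p) (b mod int p) = i"
    using u dual_mem_ideal_gens_iff[OF assms] by metis
  then show "u \<in> (\<lambda>(a, b). dual p a b) `
      {w \<in> {0..<int p} \<times> {0..<int p}. dual_ideal_index p (fst w) (snd w) = i}"
    using n_gt_1 * by (intro image_eqI[of _ _ "(a mod int p, b mod int p)"]) simp_all
next
  fix u assume "u \<in> (\<lambda>(a, b). dual p a b) `
    {w \<in> {0..<int p} \<times> {0..<int p}. dual_ideal_index p (fst w) (snd w) = i}"
  then show "u \<in> ideal_gens p i"
    unfolding dual_mem_ideal_gens_iff[OF assms, symmetric] by auto
qed

lemma inj_on_dual: "inj_on (\<lambda>(a, b). dual p a b) ({0..<int p} \<times> {0..<int p})"
  by (auto simp: inj_on_def dual_eq_iff cong_def)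

lemma finite_ideal_gens:
  assumes "i \<in> {1, 2, 3}"
  shows "finite (ideal_gens p i)"
  unfolding ideal_gens_eq_image[OF assms]
  by (intro finite_imageI, rule finite_subset[of _ "{0..<int p} \<times> {0..<int p}"]) auto

text \<open>Among least residues only 0 is divisible by \<open>p\<close>. Index 1 thus leaves the
  pair of zeros, index 2 a zero followed by a nonzero residue, and index 3 a nonzero residue
  followed by an arbitrary one.\<close>

lemma card_ideal_gens:
  "card (ideal_gens p 1) = 1" "card (ideal_gens p 2) = p - 1"
  "card (ideal_gens p 3) = p * (p - 1)"
proof -
  have *: "card (ideal_gens p i) =
      card {w \<in> {0..<int p} \<times> {0..<int p}. dual_ideal_index p (fst w) (snd w) = i}"
    if "i \<in> {1, 2, 3}" for i
    unfolding ideal_gens_eq_image[OF that]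
    by (intro card_image inj_on_subset[OF inj_on_dual]) auto
  have p: "0 < int p" using n_gt_1 by simp
  have diff: "nat (int p - 1) = p - 1" by linarith
  have dvd: "int p dvd a \<longleftrightarrow> a = 0" if "0 \<le> a" "a < int p" for a
    using that zdvd_not_zless[of a "int p"] by fastforce
  have "{w \<in> {0..<int p} \<times> {0..<int p}. dual_ideal_index p (fst w) (snd w) = 1} = {(0, 0)}"
    using p by (auto simp: dvd dual_ideal_index_def split: if_splits)
  then show "card (ideal_gens p 1) = 1" by (simp add: *)
  have "{w \<in> {0..<int p} \<times> {0..<int p}. dual_ideal_index p (fst w) (snd w) = 2} = {0} \<times> {1..<int p}"
    using p by (auto simp: dvd dual_ideal_index_def split: if_splits)
  then show "card (ideal_gens p 2) = p - 1" by (simp add: * card_cartesian_product diff)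
  have "{w \<in> {0..<int p} \<times> {0..<int p}. dual_ideal_index p (fst w) (snd w) = 3} = {1..<int p} \<times> {0..<int p}"
    using p by (auto simp: dvd dual_ideal_index_def split: if_splits)
  then show "card (ideal_gens p 3) = p * (p - 1)"
    by (simp add: * card_cartesian_product diff)
qed

end

section \<open>Two distinct primes: gluing by the Chinese remainder theorem\<close>

locale zmod_dual_two_primes =
  fixes p q :: nat
  assumes prime_p: "prime p" and prime_q: "prime q" and distinct: "p \<noteq> q"
begin

sublocale Dp: zmod_dual_field p
  by unfold_locales (rule prime_p)

sublocale Dq: zmod_dual_field q
  by unfold_locales (rule prime_q)

sublocale Dpq: zmod_dual_ring "p * q"
  using Dp.n_gt_1 Dq.n_gt_1 by unfold_locales (rule less_1_mult)

lemma coprime_pq: "coprime (int p) (int q)"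
  using primes_coprime[OF prime_p prime_q distinct] by simp

lemma cong_pq_iff: "[a = b] (mod int (p * q)) \<longleftrightarrow> [a = b] (mod int p) \<and> [a = b] (mod int q)"
  using coprime_pq by (auto simp: coprime_cong_mult cong_dvd_modulus)

lemma crt:
  obtains z where "[z = x] (mod int p)" "[z = y] (mod int q)"
  using binary_chinese_remainder_int[OF coprime_pq] by blast

lemmas reduce = reduce_mod_dual_mult[OF Dp.n_gt_1 Dq.n_gt_1]

lemma dual_mem_ideal_class_iff:
  "dual (p * q) a b \<in> ideal_class p q i j \<longleftrightarrow>
    dual p a b \<in> ideal_gens p i \<and> dual q a b \<in> ideal_gens q j"
  by (simp add: ideal_class_def ideal_gens_def reduce)

lemma ideal_class_elim:
  assumes "u \<in> ideal_class p q i j"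
  obtains a b where "u = dual (p * q) a b" "dual p a b \<in> ideal_gens p i" "dual q a b \<in> ideal_gens q j"
proof -
  from assms obtain a b where "u = dual (p * q) a b"
    unfolding ideal_class_def Dpq.carrier_zmod_dual by blast
  with assms that show thesis by (simp add: dual_mem_ideal_class_iff)
qed

text \<open>Congruence modulo \<open>p * q\<close> is congruence modulo both primes, which gives
  injectivity. Surjectivity comes from solving the simultaneous congruences for each of the two
  coordinates separately.\<close>

lemma bij_betw_ideal_class:
  "bij_betw (\<lambda>u. (reduce_mod p u, reduce_mod q u)) (ideal_class p q i j)
    (ideal_gens p i \<times> ideal_gens q j)"
proof (rule bij_betw_imageI[OF inj_onI Set.set_eqI[OF iffI]])
  fix u v assume "u \<in> ideal_class p q i j" "v \<in> ideal_class p q i j"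
    and eq: "(reduce_mod p u, reduce_mod q u) = (reduce_mod p v, reduce_mod q v)"
  then obtain a b c d where uv: "u = dual (p * q) a b" "v = dual (p * q) c d"
    by (blast elim: ideal_class_elim)
  from eq show "u = v"
    unfolding uv reduce prod.inject Dp.dual_eq_iff Dq.dual_eq_iff Dpq.dual_eq_iff cong_pq_iff
    by blast
next
  fix w assume "w \<in> (\<lambda>u. (reduce_mod p u, reduce_mod q u)) ` ideal_class p q i j"
  then show "w \<in> ideal_gens p i \<times> ideal_gens q j"
    by (auto elim!: ideal_class_elim simp: reduce)
next
  fix w assume "w \<in> ideal_gens p i \<times> ideal_gens q j"
  then obtain a b c d where w: "w = (dual p a b, dual q c d)" "dual p a b \<in> ideal_gens p i"
      "dual q c d \<in> ideal_gens q j"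
    unfolding ideal_gens_def Dp.carrier_zmod_dual Dq.carrier_zmod_dual by blast
  obtain x where x: "[x = a] (mod int p)" "[x = c] (mod int q)" by (rule crt)
  obtain y where y: "[y = b] (mod int p)" "[y = d] (mod int q)" by (rule crt)
  have e: "dual p x y = dual p a b" "dual q x y = dual q c d"
    using x y by (simp_all add: Dp.dual_eq_iff Dq.dual_eq_iff)
  show "w \<in> (\<lambda>u. (reduce_mod p u, reduce_mod q u)) ` ideal_class p q i j"
    by (rule image_eqI[of _ _ "dual (p * q) x y"]) (use w e in \<open>simp_all add: reduce dual_mem_ideal_class_iff\<close>)
qed

lemma card_ideal_class: "card (ideal_class p q i j) = card (ideal_gens p i) * card (ideal_gens q j)"
  using bij_betw_same_card[OF bij_betw_ideal_class] by (simp add: card_cartesian_product)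

lemma finite_ideal_class:
  assumes "i \<in> {1, 2, 3}" "j \<in> {1, 2, 3}"
  shows "finite (ideal_class p q i j)"
  using bij_betw_finite[OF bij_betw_ideal_class] Dp.finite_ideal_gens[OF assms(1)]
    Dq.finite_ideal_gens[OF assms(2)] by simp

lemma ideal_class_imp_mem_PIdl:
  assumes "u \<in> ideal_class p q i j" "v \<in> ideal_class p q i j"
  shows "u \<in> PIdl\<^bsub>zmod_dual (p * q)\<^esub> v"
proof -
  obtain a b where u: "u = dual (p * q) a b" "dual p a b \<in> ideal_gens p i" "dual q a b \<in> ideal_gens q j"
    using assms(1) by (rule ideal_class_elim)
  obtain c d where v: "v = dual (p * q) c d" "dual p c d \<in> ideal_gens p i" "dual q c d \<in> ideal_gens q j"
    using assms(2) by (rule ideal_class_elim)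
  \<comment> \<open>Each element lies in its own principal ideal, and the two elements generate the
    same ideal, \<open>dual_ideal p i\<close>.\<close>
  have "dual p a b \<in> PIdl\<^bsub>zmod_dual p\<^esub> (dual p c d)"
    using u(2) v(2) Dp.D.cgenideal_self[of "dual p a b"]
    by (simp add: ideal_gens_def Dp.genideal_zmod_dual)
  then obtain x y where xy: "[a = x * c] (mod int p)" "[b = x * d + y * c] (mod int p)"
    unfolding Dp.dual_mem_PIdl_iff by blast
  have "dual q a b \<in> PIdl\<^bsub>zmod_dual q\<^esub> (dual q c d)"
    using u(3) v(3) Dq.D.cgenideal_self[of "dual q a b"]
    by (simp add: ideal_gens_def Dq.genideal_zmod_dual)
  then obtain x' y' where xy': "[a = x' * c] (mod int q)" "[b = x' * d + y' * c] (mod int q)"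
    unfolding Dq.dual_mem_PIdl_iff by blast
  \<comment> \<open>The multipliers found modulo \<open>p\<close> and modulo \<open>q\<close> are
    glued coordinatewise into one multiplier modulo \<open>p * q\<close>.\<close>
  obtain X where X: "[X = x] (mod int p)" "[X = x'] (mod int q)" by (rule crt)
  obtain Y where Y: "[Y = y] (mod int p)" "[Y = y'] (mod int q)" by (rule crt)
  have "[a = X * c] (mod int p)" "[b = X * d + Y * c] (mod int p)"
    by (rule cong_trans[OF xy(1)] cong_trans[OF xy(2)],
        intro cong_add cong_mult cong_refl cong_sym[OF X(1)] cong_sym[OF Y(1)])+
  moreover have "[a = X * c] (mod int q)" "[b = X * d + Y * c] (mod int q)"
    by (rule cong_trans[OF xy'(1)] cong_trans[OF xy'(2)],
        intro cong_add cong_mult cong_refl cong_sym[OF X(2)] cong_sym[OF Y(2)])+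
  ultimately show ?thesis
    unfolding u(1) v(1) Dpq.dual_mem_PIdl_iff cong_pq_iff by blast
qed

text \<open>Zero reduces to zero in both factors and so has index pair \<open>(1, 1)\<close>; a unit
  has constant coefficient prime to both \<open>p\<close> and \<open>q\<close> and so has index pair
  \<open>(3, 3)\<close>.\<close>

lemma ideal_class_subset_verts:
  assumes ij: "i \<in> {1, 2, 3}" "j \<in> {1, 2, 3}" and ne: "(i, j) \<noteq> (1, 1)" "(i, j) \<noteq> (3, 3)"
  shows "ideal_class p q i j \<subseteq> verts (cozero_divisor_graph (zmod_dual (p * q)))"
proof
  fix u assume "u \<in> ideal_class p q i j"
  then obtain a b where u: "u = dual (p * q) a b" "dual p a b \<in> ideal_gens p i" "dual q a b \<in> ideal_gens q j"
    by (rule ideal_class_elim)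
  have "u \<noteq> \<zero>\<^bsub>zmod_dual (p * q)\<^esub>"
  proof
    assume "u = \<zero>\<^bsub>zmod_dual (p * q)\<^esub>"
    then have "dual p a b = dual p 0 0" "dual q a b = dual q 0 0"
      unfolding u(1) Dpq.zero_zmod_dual Dpq.dual_eq_iff Dp.dual_eq_iff Dq.dual_eq_iff cong_pq_iff
      by auto
    with u ne(1) show False
      by (simp add: Dp.zero_mem_ideal_gens[OF ij(1)] Dq.zero_mem_ideal_gens[OF ij(2)])
  qed
  moreover have "u \<notin> Units (zmod_dual (p * q))"
  proof
    assume "u \<in> Units (zmod_dual (p * q))"
    then obtain v where "v \<in> carrier (zmod_dual (p * q))"
        "u \<otimes>\<^bsub>zmod_dual (p * q)\<^esub> v = \<one>\<^bsub>zmod_dual (p * q)\<^esub>"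
      by (auto simp: Units_def)
    \<comment> \<open>Comparing constant coefficients in the equation \<open>u * v = 1\<close> shows
      that \<open>a\<close> is invertible modulo \<open>p * q\<close>.\<close>
    then obtain c where "[a * c = 1] (mod int (p * q))"
      unfolding u(1) Dpq.carrier_zmod_dual
      by (auto simp: Dpq.mult_dual Dpq.one_zmod_dual Dpq.dual_eq_iff simp del: of_nat_mult)
    then have "coprime a (int p)" "coprime a (int q)"
      unfolding cong_pq_iff by (auto simp: coprime_iff_invertible_int)
    then have "\<not> int p dvd a" "\<not> int q dvd a"
      using Dp.n_gt_1 Dq.n_gt_1 by (auto dest: coprime_common_divisor)
    with u ne(2) show False
      by (simp add: Dp.dual_mem_ideal_gens_iff[OF ij(1)] Dq.dual_mem_ideal_gens_iff[OF ij(2)]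
          dual_ideal_index_def)
  qed
  ultimately show "u \<in> verts (cozero_divisor_graph (zmod_dual (p * q)))"
    using u(1) by (simp add: cozero_divisor_graph_def Let_def)
qed

end

section \<open>Edgeless graphs and assembly of the seven isomorphisms\<close>

lemma digraph_iso_edgeless_graph:
  fixes G :: "('a, 'b) pre_digraph"
  assumes "arcs G = {}" "finite (verts G)"
  shows "digraph_iso G (edgeless_graph (card (verts G)))"
proof -
  obtain f where f: "bij_betw f (verts G) {..<card (verts G)}"
    using ex_bij_betw_finite_nat[OF assms(2)] by (auto simp: atLeast0LessThan)
  \<comment> \<open>There is no arc to map, so \<open>iso_arcs\<close> may be
    \<open>undefined\<close>; the projections as head and tail match those fixed by
    \<open>with_proj\<close> in \<open>edgeless_graph\<close>.\<close>
  define h :: "(_, 'b, _, _) digraph_isomorphism"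
    where "h = \<lparr>iso_verts = f, iso_arcs = (\<lambda>_. undefined), iso_head = snd, iso_tail = fst\<rparr>"
  have "pre_digraph.digraph_isomorphism G h"
    using assms(1) f
    by (auto simp: pre_digraph.digraph_isomorphism_def h_def wf_digraph_def bij_betw_def)
  moreover have "edgeless_graph (card (verts G)) = app_iso h G"
    using assms(1) f
    by (simp add: edgeless_graph_def with_proj_def app_iso_def h_def bij_betw_def)
  ultimately show ?thesis
    unfolding digraph_iso_def by blast
qed

lemma (in zmod_dual_two_primes) digraph_iso_ideal_class:
  assumes "i \<in> {1, 2, 3}" "j \<in> {1, 2, 3}"
  shows "digraph_iso (cozero_divisor_graph (zmod_dual (p * q)) \<restriction> ideal_class p q i j)
    (edgeless_graph (card (ideal_gens p i) * card (ideal_gens q j)))"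
proof -
  let ?G = "cozero_divisor_graph (zmod_dual (p * q)) \<restriction> ideal_class p q i j"
  \<comment> \<open>An arc would need two vertices neither of which is a multiple of the other,
    whereas members of one class are multiples of each other.\<close>
  have "arcs ?G = {}"
    using ideal_class_imp_mem_PIdl by (auto simp: cozero_divisor_graph_def Let_def)
  then have "digraph_iso ?G (edgeless_graph (card (verts ?G)))"
    using finite_ideal_class[OF assms] by (intro digraph_iso_edgeless_graph) simp_all
  then show ?thesis by (simp add: card_ideal_class)
qed

theorem theorem3p4:
  fixes p q :: nat
  assumes "prime p" and "prime q" and "p \<noteq> q"
  defines "\<Gamma> \<equiv> cozero_divisor_graph (zmod_dual (p * q))"
    and "A \<equiv> ideal_class p q"
  shows "(\<forall>(i, j) \<in> {(1,2), (2,1), (1,3), (3,1), (2,2), (2,3), (3,2)}. A i j \<subseteq> verts \<Gamma>)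
    \<and> digraph_iso (\<Gamma> \<restriction> A 1 2) (edgeless_graph (q - 1))
    \<and> digraph_iso (\<Gamma> \<restriction> A 2 1) (edgeless_graph (p - 1))
    \<and> digraph_iso (\<Gamma> \<restriction> A 1 3) (edgeless_graph (q * (q - 1)))
    \<and> digraph_iso (\<Gamma> \<restriction> A 3 1) (edgeless_graph (p * (p - 1)))
    \<and> digraph_iso (\<Gamma> \<restriction> A 2 2) (edgeless_graph ((p - 1) * (q - 1)))
    \<and> digraph_iso (\<Gamma> \<restriction> A 2 3) (edgeless_graph (q * (p - 1) * (q - 1)))
    \<and> digraph_iso (\<Gamma> \<restriction> A 3 2) (edgeless_graph (p * (p - 1) * (q - 1)))"
proof -
  interpret zmod_dual_two_primes p q
    using assms(1-3) by unfold_locales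
  note card = Dp.card_ideal_gens Dq.card_ideal_gens
  have iso: "digraph_iso (\<Gamma> \<restriction> A i j) (edgeless_graph (card (ideal_gens p i) * card (ideal_gens q j)))"
    if "i \<in> {1, 2, 3}" "j \<in> {1, 2, 3}" for i j
    using digraph_iso_ideal_class[OF that] unfolding A_def \<Gamma>_def .
  have "A i j \<subseteq> verts \<Gamma>" if "(i, j) \<in> {(1,2), (2,1), (1,3), (3,1), (2,2), (2,3), (3,2)}" for i j
    using that unfolding A_def \<Gamma>_def by (intro ideal_class_subset_verts) auto
  then have "\<forall>(i, j) \<in> {(1,2), (2,1), (1,3), (3,1), (2,2), (2,3), (3,2)}. A i j \<subseteq> verts \<Gamma>"
    by blast
  \<comment> \<open>The zero ideal has a single generator, so an index 1 contributes the factor 1 to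
    the number of vertices.\<close>
  moreover have "digraph_iso (\<Gamma> \<restriction> A 1 2) (edgeless_graph (q - 1))"
    using iso[of 1 2] unfolding card by (simp add: ac_simps)
  moreover have "digraph_iso (\<Gamma> \<restriction> A 2 1) (edgeless_graph (p - 1))"
    using iso[of 2 1] unfolding card by (simp add: ac_simps)
  moreover have "digraph_iso (\<Gamma> \<restriction> A 1 3) (edgeless_graph (q * (q - 1)))"
    using iso[of 1 3] unfolding card by (simp add: ac_simps)
  moreover have "digraph_iso (\<Gamma> \<restriction> A 3 1) (edgeless_graph (p * (p - 1)))"
    using iso[of 3 1] unfolding card by (simp add: ac_simps)
  moreover have "digraph_iso (\<Gamma> \<restriction> A 2 2) (edgeless_graph ((p - 1) * (q - 1)))"
    using iso[of 2 2] unfolding card by (simp add: ac_simps)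
  moreover have "digraph_iso (\<Gamma> \<restriction> A 2 3) (edgeless_graph (q * (p - 1) * (q - 1)))"
    using iso[of 2 3] unfolding card by (simp add: ac_simps)
  moreover have "digraph_iso (\<Gamma> \<restriction> A 3 2) (edgeless_graph (p * (p - 1) * (q - 1)))"
    using iso[of 3 2] unfolding card by (simp add: ac_simps)
  ultimately show ?thesis
    by (intro conjI)
qed

end
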